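(* Let $f,g_1,\ldots,g_m\in\mathbb{R}[\mathbf{x}]$ be real polynomials in $\mathbf{x}=(x_1,\ldots,x_n)$, let $\mathbf{K}=\{\mathbf{x}\in\mathbb{R}^n : g_j(\mathbf{x})\ge 0,\ j=1,\ldots,m\}$, where $0\le g_j\le 1$ on $\mathbf{K}$ for every $j=1,\ldots,m$, and consider the problem $f^*=\min\{f(\mathbf{x}) : \mathbf{x}\in\mathbf{K}\}$. Let $f$ and $-g_j$, $j=1,\ldots,m$, be convex, let Slater's condition hold (there exists $\mathbf{x}_0\in\mathbf{K}$ with $g_j(\mathbf{x}_0)>0$ for every $j=1,\ldots,m$), and let $f^*>-\infty$. For integers $d\ge 1$ and $k\ge 0$, let $q^k_d$ be the optimal value of the level-$d$ semidefinite relaxation with parameter $k$ (defined in the context). Then: (a) If $\max[\deg f,\deg g_j]\le 2$ (the maximum being taken over $f$ and all $g_j$), then $q^1_1=f^*$, i.e., the first relaxation ($d=1$) of the hierarchy with parameter $k=1$ is exact. (b) If $\max[\deg f,\deg g_j]\le 2k$ and $f,-g_1,\ldots,-g_m$ are all SOS-convex, then $q^k_1=f^*$, i.e., the first relaxation ($d=1$) of the hierarchy with parameter $k$ is exact.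
   Context: $\Sigma[\mathbf{x}]_k$ is the set of polynomials of degree at most $2k$ that are sums of squares of polynomials. A polynomial is SOS-convex if it is convex and its Hessian matrix factors as $L(\mathbf{x})L(\mathbf{x})^T$ for some rectangular matrix polynomial $L$. For an integer $d\ge1$ let $\mathbb{N}^{2m}_d=\{(\alpha,\beta)\in\mathbb{N}^m\times\mathbb{N}^m : \sum_{j=1}^m(\alpha_j+\beta_j)\le d\}$ (with $0\in\mathbb{N}$), and for a real vector $\lambda=(\lambda_{\alpha\beta})_{(\alpha,\beta)\in\mathbb{N}^{2m}_d}$ let $$L_d(\mathbf{x},\lambda)=f(\mathbf{x})-\sum_{(\alpha,\beta)\in\mathbb{N}^{2m}_d}\lambda_{\alpha\beta}\Big(\prod_{j=1}^m g_j(\mathbf{x})^{\alpha_j}\Big)\Big(\prod_{j=1}^m(1-g_j(\mathbf{x}))^{\beta_j}\Big).$$ The level-$d$ semidefinite relaxation with parameter $k$ is $$q^k_d=\max_{\lambda,t,\sigma}\{t : L_d(\mathbf{x},\lambda)-t=\sigma(\mathbf{x})\ \ \forall\mathbf{x}\in\mathbb{R}^n;\ \lambda\ge0;\ t\in\mathbb{R};\ \sigma\in\Sigma[\mathbf{x}]_k\}.$$ In particular, for $d=1$ the multipliers are those of the constant $1$, of the $g_j$ and of the $1-g_j$, $j=1,\ldots,m$. *)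

theory Defs
  imports "HOL-Analysis.Analysis" "HOL-Library.Poly_Mapping" "HOL-Library.Extended_Real"
begin

text \<open>Real polynomials in the variables indexed by the finite type \<open>'n\<close>: finitely
  supported maps from exponent vectors to coefficients, with the ring structure of
  \<^theory>\<open>HOL-Library.Poly_Mapping\<close>.\<close>

type_synonym 'n rpoly = "('n \<Rightarrow>\<^sub>0 nat) \<Rightarrow>\<^sub>0 real"

definition peval :: "'n::finite rpoly \<Rightarrow> real ^ 'n \<Rightarrow> real" where
  "peval p x = (\<Sum>e\<in>Poly_Mapping.keys p.
      Poly_Mapping.lookup p e * (\<Prod>i\<in>UNIV. (x $ i) ^ Poly_Mapping.lookup e i))"

text \<open>The zero polynomial gets degree \<open>0\<close>.\<close>

definition total_degree :: "'n::finite rpoly \<Rightarrow> nat" where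
  "total_degree p =
    Max (insert 0 ((\<lambda>e. \<Sum>i\<in>UNIV. Poly_Mapping.lookup e i) ` Poly_Mapping.keys p))"

text \<open>The truncated subtraction of exponents is harmless: if \<open>Poly_Mapping.lookup e i = 0\<close>,
  then the coefficient vanishes.\<close>

definition partial_deriv :: "'n::finite \<Rightarrow> 'n rpoly \<Rightarrow> 'n rpoly" where
  "partial_deriv i p =
    (\<Sum>e\<in>Poly_Mapping.keys p.
      Poly_Mapping.single (e - Poly_Mapping.single i 1)
        (real (Poly_Mapping.lookup e i) * Poly_Mapping.lookup p e))"

definition hessian :: "'n::finite rpoly \<Rightarrow> 'n \<Rightarrow> 'n \<Rightarrow> 'n rpoly" where
  "hessian p i j = partial_deriv i (partial_deriv j p)"

definition SOS :: "nat \<Rightarrow> 'n::finite rpoly set" where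
  "SOS k = {\<sigma>. total_degree \<sigma> \<le> 2 * k \<and>
                (\<exists>(r::nat) (h :: nat \<Rightarrow> 'n rpoly). \<sigma> = (\<Sum>l<r. (h l)\<^sup>2))}"

text \<open>The rectangular matrix polynomial \<open>L\<close> has rows indexed by \<open>'n\<close> and \<open>r\<close> columns.\<close>

definition sos_convex :: "'n::finite rpoly \<Rightarrow> bool" where
  "sos_convex p \<longleftrightarrow> convex_on UNIV (peval p) \<and>
     (\<exists>(r::nat) (L :: 'n \<Rightarrow> nat \<Rightarrow> 'n rpoly).
        \<forall>i j. hessian p i j = (\<Sum>l<r. L i l * L j l))"

text \<open>The constraints are indexed by a finite type \<open>'m\<close>.\<close>

definition feasible_set :: "('m::finite \<Rightarrow> 'n::finite rpoly) \<Rightarrow> (real ^ 'n) set" where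
  "feasible_set g = {x. \<forall>j. peval (g j) x \<ge> 0}"

text \<open>The optimal value is the infimum in the extended reals; attainment is not assumed.\<close>

definition opt_value :: "'n::finite rpoly \<Rightarrow> ('m::finite \<Rightarrow> 'n rpoly) \<Rightarrow> ereal" where
  "opt_value f g = (INF x\<in>feasible_set g. ereal (peval f x))"

definition multi_indices :: "nat \<Rightarrow> (('m::finite \<Rightarrow> nat) \<times> ('m \<Rightarrow> nat)) set" where
  "multi_indices d = {(\<alpha>, \<beta>). (\<Sum>j\<in>UNIV. \<alpha> j + \<beta> j) \<le> d}"

text \<open>Finiteness ensures that the sum over \<^const>\<open>multi_indices\<close> in the Lagrangian below is
  the intended one.\<close>

lemma finite_multi_indices: "finite (multi_indices d :: (('m::finite \<Rightarrow> nat) \<times> ('m \<Rightarrow> nat)) set)"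
proof -
  let ?B = "UNIV \<rightarrow>\<^sub>E {..d} :: ('m \<Rightarrow> nat) set"
  have "(\<alpha>, \<beta>) \<in> ?B \<times> ?B" if le: "(\<Sum>j\<in>UNIV. \<alpha> j + \<beta> j) \<le> d" for \<alpha> \<beta> :: "'m \<Rightarrow> nat"
  proof -
    have "\<alpha> i + \<beta> i \<le> d" for i
      using member_le_sum[of i UNIV "\<lambda>j. \<alpha> j + \<beta> j"] le by (simp add: order_trans)
    then show ?thesis
      by (auto simp: PiE_def Pi_def intro: add_leD1 add_leD2)
  qed
  then have "multi_indices d \<subseteq> ?B \<times> ?B"
    by (auto simp only: multi_indices_def)
  moreover have "finite (?B \<times> ?B)"
    by (intro finite_cartesian_product finite_PiE) auto
  ultimately show ?thesis
    by (rule finite_subset)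
qed

definition lagrangian ::
  "'n::finite rpoly \<Rightarrow> ('m::finite \<Rightarrow> 'n rpoly) \<Rightarrow> nat \<Rightarrow>
   (('m \<Rightarrow> nat) \<times> ('m \<Rightarrow> nat) \<Rightarrow> real) \<Rightarrow> real ^ 'n \<Rightarrow> real" where
  "lagrangian f g d lam x =
     peval f x - (\<Sum>(\<alpha>, \<beta>)\<in>multi_indices d.
        lam (\<alpha>, \<beta>) * (\<Prod>j\<in>UNIV. peval (g j) x ^ \<alpha> j) * (\<Prod>j\<in>UNIV. (1 - peval (g j) x) ^ \<beta> j))"

text \<open>The objective values \<open>t\<close> of the feasible points \<open>(\<lambda>, t, \<sigma>)\<close> of the relaxation.\<close>

definition relax_values ::
  "'n::finite rpoly \<Rightarrow> ('m::finite \<Rightarrow> 'n rpoly) \<Rightarrow> nat \<Rightarrow> nat \<Rightarrow> real set" where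
  "relax_values f g d k =
     {t. \<exists>lam. \<exists>\<sigma>\<in>SOS k. (\<forall>ab\<in>multi_indices d. lam ab \<ge> 0) \<and>
           (\<forall>x. lagrangian f g d lam x - t = peval \<sigma> x)}"

definition relax_value ::
  "'n::finite rpoly \<Rightarrow> ('m::finite \<Rightarrow> 'n rpoly) \<Rightarrow> nat \<Rightarrow> nat \<Rightarrow> ereal" where
  "relax_value f g d k = (SUP t\<in>relax_values f g d k. ereal t)"

end

theory Submission
  imports Defs "HOL-Computational_Algebra.Polynomial"
begin

text \<open>
The relaxation never exceeds the optimal value \<open>f\<^sup>*\<close> by weak duality. It is exact at the
first level because Slater's condition provides multipliers
\<open>\<mu> \<ge> 0\<close> such that \<open>F = f - \<Sum>\<^sub>j \<mu>\<^sub>j g\<^sub>j\<close> satisfies \<open>F \<ge> f\<^sup>*\<close> on the whole space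
(\<open>slater_multipliers\<close>). The products of constraints of order one include the \<open>g\<^sub>j\<close> themselves, so it
remains to see that the nonnegative polynomial \<open>F - f\<^sup>*\<close> is a sum of squares; its degree is at
most that of the data.

The polynomial \<open>F\<close> is convex and its Hessian is a sum of matrices \<open>L L\<^sup>T\<close>, hence of this form
itself. It is bounded below, and therefore attains its minimum at some point \<open>z\<close>
(\<open>convex_poly_bounded_below_attains_min\<close>): otherwise minimizing points of least norm would run off to
infinity in a direction along which \<open>F\<close> is constant, and could be moved closer to the origin. At
\<open>z\<close> the gradient vanishes, and Taylor's formula with integral remainder expresses \<open>F - F z\<close> as an
integral of squares, which is a sum of squares because the moment matrix of the weight \<open>1 - t\<close> on
the unit interval is positive semidefinite (\<open>gram_diff_at_critical_point\<close>). Adding the constant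
\<open>F z - f\<^sup>* \<ge> 0\<close> gives the required certificate.

For quadratic data, the Hessians are constant positive semidefinite matrices, which factor by
Cholesky's method (\<open>psd_factorization\<close>); so convexity implies SOS-convexity and the quadratic case
is the case \<open>k = 1\<close> of the other one.
\<close>

section \<open>Evaluation of polynomials\<close>

lemma poly_mapping_sum_singles:
  fixes p :: "'a \<Rightarrow>\<^sub>0 'b::comm_monoid_add"
  shows "p = (\<Sum>e\<in>Poly_Mapping.keys p. Poly_Mapping.single e (Poly_Mapping.lookup p e))"
  by (rule poly_mapping_eqI)
    (auto simp: lookup_sum lookup_single when_def in_keys_iff cong: if_cong)

text \<open>Additive operations on polynomials (evaluation, partial derivatives) are determined by their
values on monomials; this induction reduces their algebraic laws to that case.\<close>

lemma poly_mapping_single_induct [case_names single add]: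
  fixes p :: "'a \<Rightarrow>\<^sub>0 'b::comm_monoid_add"
  assumes single: "\<And>e c. P (Poly_Mapping.single e c)"
    and add: "\<And>p q. P p \<Longrightarrow> P q \<Longrightarrow> P (p + q)"
  shows "P p"
proof -
  have "P (\<Sum>e\<in>A. Poly_Mapping.single e (Poly_Mapping.lookup p e))" if "finite A" for A
    using that
  proof (induction A rule: finite_induct)
    case empty
    show ?case using single[of undefined 0] by simp
  next
    case (insert a A)
    then show ?case using single add by simp
  qed
  from this[OF finite_keys] show ?thesis
    by (metis poly_mapping_sum_singles)
qed

definition monomial_value :: "('n::finite \<Rightarrow>\<^sub>0 nat) \<Rightarrow> real ^ 'n \<Rightarrow> real" where
  "monomial_value e x = (\<Prod>i\<in>UNIV. (x $ i) ^ Poly_Mapping.lookup e i)"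

lemma monomial_value_0 [simp]: "monomial_value 0 x = 1"
  by (simp add: monomial_value_def)

lemma monomial_value_add: "monomial_value (a + b) x = monomial_value a x * monomial_value b x"
  by (simp add: monomial_value_def lookup_add power_add prod.distrib)

lemma peval_superset:
  assumes "finite A" "Poly_Mapping.keys p \<subseteq> A"
  shows "peval p x = (\<Sum>e\<in>A. Poly_Mapping.lookup p e * monomial_value e x)"
  unfolding peval_def monomial_value_def
  by (rule sum.mono_neutral_left) (use assms in \<open>auto simp: in_keys_iff\<close>)

lemma peval_add [simp]: "peval (p + q) x = peval p x + peval q x"
proof -
  let ?A = "Poly_Mapping.keys p \<union> Poly_Mapping.keys q"
  have "Poly_Mapping.keys (p + q) \<subseteq> ?A" by (rule keys_add)
  then show ?thesis
    by (simp add: peval_superset[of ?A] lookup_add distrib_right sum.distrib)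
qed

lemma peval_single [simp]: "peval (Poly_Mapping.single e c) x = c * monomial_value e x"
  by (subst peval_superset[of "{e}"]) auto

lemma peval_0 [simp]: "peval 0 x = 0"
  by (simp add: peval_def)

lemma peval_1 [simp]: "peval 1 x = 1"
  by (metis mult_1 monomial_value_0 peval_single single_one)

lemma peval_uminus [simp]: "peval (- p) x = - peval p x"
  using peval_add[of p "- p" x] by simp

lemma peval_diff [simp]: "peval (p - q) x = peval p x - peval q x"
  using peval_add[of "p - q" q x] by simp

lemma peval_sum [simp]: "peval (\<Sum>a\<in>A. p a) x = (\<Sum>a\<in>A. peval (p a) x)"
  by (induction A rule: infinite_finite_induct) auto

lemma peval_mult [simp]: "peval (p * q) x = peval p x * peval q x"
proof (induction p rule: poly_mapping_single_induct)
  case (single e c)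
  show ?case
    by (induction q rule: poly_mapping_single_induct)
      (auto simp: mult_single monomial_value_add algebra_simps)
qed (auto simp: algebra_simps)

lemma peval_power [simp]: "peval (p ^ n) x = peval p x ^ n"
  by (induction n) auto

lemma peval_prod [simp]: "peval (\<Prod>a\<in>A. p a) x = (\<Prod>a\<in>A. peval (p a) x)"
  by (induction A rule: infinite_finite_induct) auto

definition pconst :: "real \<Rightarrow> 'n::finite rpoly" where
  "pconst c = Poly_Mapping.single 0 c"

definition pvar :: "'n::finite \<Rightarrow> 'n rpoly" where
  "pvar i = Poly_Mapping.single (Poly_Mapping.single i 1) 1"

lemma peval_pconst [simp]: "peval (pconst c) x = c"
  by (simp add: pconst_def)

lemma peval_pvar [simp]: "peval (pvar i) x = x $ i"
proof -
  have "(\<Prod>j\<in>UNIV. (x $ j) ^ Poly_Mapping.lookup (Poly_Mapping.single i (1::nat)) j)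
      = (\<Prod>j\<in>UNIV. if j = i then x $ i else 1)"
    by (rule prod.cong) (auto simp: lookup_single when_def)
  then show ?thesis
    by (simp add: pvar_def monomial_value_def)
qed

lemma continuous_on_peval: "continuous_on S (peval p)"
  unfolding peval_def[abs_def] by (intro continuous_intros)

text \<open>Uniqueness of base-\<open>B\<close> digits: the lowest digit is the residue modulo \<open>B\<close>, and the remaining ones
are the digits of the quotient.\<close>

lemma base_expansion_unique:
  assumes "\<And>i. i < n \<Longrightarrow> d i < B" "\<And>i. i < n \<Longrightarrow> d' i < (B::nat)"
    and "(\<Sum>i<n. d i * B ^ i) = (\<Sum>i<n. d' i * B ^ i)" and "i < n"
  shows "d i = d' i"
  using assms
proof (induction n arbitrary: d d' i)
  case (Suc n)
  have shift: "(\<Sum>i<Suc n. c i * B ^ i) = c 0 + B * (\<Sum>i<n. c (Suc i) * B ^ i)" for c :: "nat \<Rightarrow> nat"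
    by (simp add: sum.lessThan_Suc_shift sum_distrib_left algebra_simps del: sum.lessThan_Suc)
  have eq: "d 0 + B * (\<Sum>i<n. d (Suc i) * B ^ i) = d' 0 + B * (\<Sum>i<n. d' (Suc i) * B ^ i)"
    using Suc.prems(3) unfolding shift .
  have lt: "d 0 < B" "d' 0 < B" using Suc.prems by auto
  have d0: "d 0 = d' 0"
    using arg_cong[OF eq, of "\<lambda>x. x mod B"] lt by simp
  then have "(\<Sum>i<n. d (Suc i) * B ^ i) = (\<Sum>i<n. d' (Suc i) * B ^ i)"
    using eq lt by simp
  then have "d (Suc j) = d' (Suc j)" if "j < n" for j
    using Suc.IH[of "\<lambda>i. d (Suc i)" "\<lambda>i. d' (Suc i)" j] Suc.prems that by auto
  with d0 show ?case using Suc.prems(4) by (cases i) auto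
qed simp

text \<open>Kronecker substitution: putting \<open>x\<^sub>i = t ^ (B ^ i)\<close> with \<open>B\<close> larger than all exponents
sends different monomials to different powers of \<open>t\<close>, so the coefficients of \<open>p\<close> become the
coefficients of a real polynomial in \<open>t\<close> that vanishes identically. Hence identities between
polynomials, in particular sum-of-squares representations, may be checked pointwise.\<close>

lemma peval_eq_0_imp_0:
  fixes p :: "'n::finite rpoly"
  assumes "\<And>x. peval p x = 0"
  shows "p = 0"
proof -
  let ?l = "Poly_Mapping.lookup"
  define n where "n = CARD('n)"
  \<comment> \<open>An arbitrary numbering of the variables, which gives each of them a digit position.\<close>
  obtain \<iota> :: "nat \<Rightarrow> 'n" where \<iota>: "bij_betw \<iota> {..<n} UNIV"
    using ex_bij_betw_nat_finite[of "UNIV :: 'n set"] by (auto simp: n_def atLeast0LessThan)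
  define B where "B = Suc (Max (insert 0 ((\<lambda>(e, i). ?l e i) ` (Poly_Mapping.keys p \<times> UNIV))))"
  have B: "?l e i < B" if "e \<in> Poly_Mapping.keys p" for e i
    unfolding B_def less_Suc_eq_le using that by (intro Max_ge) (auto intro!: image_eqI[of _ _ "(e,i)"])
  define code where "code e = (\<Sum>i<n. ?l e (\<iota> i) * B ^ i)" for e
  have inj: "inj_on code (Poly_Mapping.keys p)"
  proof (rule inj_onI)
    fix e e' assume e: "e \<in> Poly_Mapping.keys p" "e' \<in> Poly_Mapping.keys p" "code e = code e'"
    have "?l e (\<iota> i) = ?l e' (\<iota> i)" if "i < n" for i
      using base_expansion_unique[of n "\<lambda>i. ?l e (\<iota> i)" B "\<lambda>i. ?l e' (\<iota> i)" i] e that B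
      by (auto simp: code_def)
    then have "?l e j = ?l e' j" for j
      using bij_betw_imp_surj_on[OF \<iota>] by (metis UNIV_I imageE lessThan_iff)
    then show "e = e'" by (rule poly_mapping_eqI)
  qed
  define q where "q = (\<Sum>e\<in>Poly_Mapping.keys p. monom (?l p e) (code e))"
  have "poly q t = 0" for t
  proof -
    define x :: "real ^ 'n" where "x = (\<chi> j. t ^ (B ^ (inv_into {..<n} \<iota> j)))"
    have x_coord: "x $ \<iota> i = t ^ (B ^ i)" if "i < n" for i
      using inv_into_f_f[OF bij_betw_imp_inj_on[OF \<iota>], of i] that by (simp add: x_def)
    have "monomial_value e x = t ^ code e" for e
    proof -
      have "monomial_value e x = (\<Prod>i<n. (x $ \<iota> i) ^ ?l e (\<iota> i))"
        unfolding monomial_value_def by (rule prod.reindex_bij_betw[OF \<iota>, symmetric])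
      also have "\<dots> = (\<Prod>i<n. t ^ (?l e (\<iota> i) * B ^ i))"
        by (rule prod.cong) (simp_all add: x_coord power_mult[symmetric] mult.commute)
      finally show ?thesis by (simp add: code_def power_sum)
    qed
    then have "poly q t = peval p x"
      by (subst peval_superset[of "Poly_Mapping.keys p"]) (auto simp: q_def poly_sum poly_monom)
    then show ?thesis using assms by simp
  qed
  then have "q = 0" using poly_all_0_iff_0 by blast
  have "?l p e = 0" if e: "e \<in> Poly_Mapping.keys p" for e
  proof -
    have "coeff q (code e) = (\<Sum>e'\<in>Poly_Mapping.keys p. if e' = e then ?l p e else 0)"
      unfolding q_def coeff_sum
      by (rule sum.cong) (use e in \<open>auto simp: inj_on_eq_iff[OF inj]\<close>)
    then show ?thesis using \<open>q = 0\<close> e by simp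
  qed
  then show ?thesis
    by (metis in_keys_iff keys_eq_empty ex_in_conv)
qed

lemma peval_inject:
  assumes "\<And>x. peval p x = peval q x"
  shows "p = q"
  using peval_eq_0_imp_0[of "p - q"] assms by simp

section \<open>Degrees and partial derivatives\<close>

lemma total_degree_le_iff:
  "total_degree p \<le> d \<longleftrightarrow> (\<forall>e\<in>Poly_Mapping.keys p. (\<Sum>i\<in>UNIV. Poly_Mapping.lookup e i) \<le> d)"
  by (auto simp: total_degree_def)

lemma total_degree_add_le:
  "total_degree p \<le> d \<Longrightarrow> total_degree q \<le> d \<Longrightarrow> total_degree (p + q) \<le> d"
  using keys_add[of p q] by (auto simp: total_degree_le_iff)

lemma total_degree_pconst_mult_le:
  assumes "total_degree p \<le> d"
  shows "total_degree (pconst c * p) \<le> d"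
proof -
  have "Poly_Mapping.keys (pconst c * p) \<subseteq> Poly_Mapping.keys p"
    using keys_mult[of "pconst c" p] by (fastforce simp: pconst_def split: if_splits)
  then show ?thesis using assms by (auto simp: total_degree_le_iff)
qed

lemma total_degree_pconst [simp]: "total_degree (pconst c) = 0"
  by (auto simp: total_degree_def pconst_def)

lemma total_degree_uminus [simp]: "total_degree (- p) = total_degree p"
  by (simp add: total_degree_def Poly_Mapping.keys_def lookup_uminus)

lemma total_degree_sum_le:
  "(\<And>a. a \<in> A \<Longrightarrow> total_degree (p a) \<le> d) \<Longrightarrow> total_degree (\<Sum>a\<in>A. p a) \<le> d"
  by (induction A rule: infinite_finite_induct)
    (auto simp: total_degree_add_le, auto simp: total_degree_def)

lemma partial_deriv_superset:
  assumes "finite A" "Poly_Mapping.keys p \<subseteq> A"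
  shows "partial_deriv i p = (\<Sum>e\<in>A. Poly_Mapping.single (e - Poly_Mapping.single i 1)
        (real (Poly_Mapping.lookup e i) * Poly_Mapping.lookup p e))"
  unfolding partial_deriv_def
  by (rule sum.mono_neutral_left) (use assms in \<open>auto simp: in_keys_iff\<close>)

lemma partial_deriv_single [simp]:
  "partial_deriv i (Poly_Mapping.single e c) =
     Poly_Mapping.single (e - Poly_Mapping.single i 1) (real (Poly_Mapping.lookup e i) * c)"
  by (subst partial_deriv_superset[of "{e}"]) auto

lemma partial_deriv_add [simp]: "partial_deriv i (p + q) = partial_deriv i p + partial_deriv i q"
proof -
  let ?A = "Poly_Mapping.keys p \<union> Poly_Mapping.keys q"
  have "Poly_Mapping.keys (p + q) \<subseteq> ?A" by (rule keys_add)
  then show ?thesis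
    by (simp add: partial_deriv_superset[of ?A] lookup_add distrib_left sum.distrib single_add)
qed

lemma partial_deriv_0 [simp]: "partial_deriv i 0 = 0"
  by (simp add: partial_deriv_def)

lemma partial_deriv_sum: "partial_deriv i (\<Sum>a\<in>A. p a) = (\<Sum>a\<in>A. partial_deriv i (p a))"
  by (induction A rule: infinite_finite_induct) auto

lemma partial_deriv_pconst_mult: "partial_deriv i (pconst c * p) = pconst c * partial_deriv i p"
  by (induction p rule: poly_mapping_single_induct)
    (auto simp: pconst_def mult_single algebra_simps)

lemma partial_deriv_commute:
  "partial_deriv i (partial_deriv j p) = partial_deriv j (partial_deriv i p)"
proof (induction p rule: poly_mapping_single_induct)
  case (single e c)
  have "e - Poly_Mapping.single j 1 - Poly_Mapping.single i 1
      = e - Poly_Mapping.single i 1 - Poly_Mapping.single j 1"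
    by (rule poly_mapping_eqI) (simp add: lookup_minus)
  then show ?case
    by (cases "i = j") (simp_all add: lookup_minus lookup_single when_def algebra_simps)
qed auto

lemma total_degree_partial_deriv_le:
  assumes "total_degree p \<le> Suc d"
  shows "total_degree (partial_deriv i p) \<le> d"
proof -
  have "total_degree (Poly_Mapping.single (e - Poly_Mapping.single i 1) 
      (real (Poly_Mapping.lookup e i) * c)) \<le> d"
    if "(\<Sum>j\<in>UNIV. Poly_Mapping.lookup e j) \<le> Suc d" for e c
  proof (cases "Poly_Mapping.lookup e i = 0")
    case True
    then show ?thesis by (simp add: total_degree_def)
  next
    case False
    have "Poly_Mapping.lookup e j = Poly_Mapping.lookup (e - Poly_Mapping.single i 1) j + (if j = i then 1 else 0)" for j
      using False by (auto simp: lookup_minus lookup_single)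
    then have "(\<Sum>j\<in>UNIV. Poly_Mapping.lookup e j)
        = (\<Sum>j\<in>UNIV. Poly_Mapping.lookup (e - Poly_Mapping.single i 1) j + (if j = i then 1 else 0))"
      by (intro sum.cong) auto
    also have "\<dots> = (\<Sum>j\<in>UNIV. Poly_Mapping.lookup (e - Poly_Mapping.single i 1) j) + 1"
      by (subst sum.distrib) simp
    finally show ?thesis using that by (auto simp: total_degree_le_iff)
  qed
  then show ?thesis
    using assms unfolding partial_deriv_def total_degree_le_iff[of p]
    by (intro total_degree_sum_le) auto
qed

lemma total_degree_0_imp_pconst:
  assumes "total_degree p = 0"
  shows "\<exists>c. p = pconst c"
proof -
  have "e = 0" if "e \<in> Poly_Mapping.keys p" for e
    using assms that total_degree_le_iff[of p 0] by (intro poly_mapping_eqI) auto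
  then have "p = pconst (Poly_Mapping.lookup p 0)"
    unfolding pconst_def by (intro poly_mapping_eqI) (metis in_keys_iff lookup_single_eq lookup_single_not_eq)
  then show ?thesis ..
qed

lemma peval_line_derivative:
  "((\<lambda>t. peval p (x + t *\<^sub>R y)) has_real_derivative
     (\<Sum>i\<in>UNIV. y $ i * peval (partial_deriv i p) (x + t *\<^sub>R y))) (at t)"
proof (induction p rule: poly_mapping_single_induct)
  case (single e c)
  let ?z = "x + t *\<^sub>R y"
  let ?l = "Poly_Mapping.lookup"
  have split: "(\<Prod>j\<in>UNIV - {i}. ?z $ j ^ ?l e j) * (real (?l e i) * ?z $ i ^ (?l e i - 1))
      = real (?l e i) * monomial_value (e - Poly_Mapping.single i 1) ?z" for i
  proof -
    have "(\<Prod>j\<in>UNIV - {i}. ?z $ j ^ ?l e j)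
        = (\<Prod>j\<in>UNIV - {i}. ?z $ j ^ ?l (e - Poly_Mapping.single i 1) j)"
      by (rule prod.cong) (auto simp: lookup_minus lookup_single)
    then show ?thesis
      by (simp add: monomial_value_def prod.remove[of UNIV i] lookup_minus)
  qed
  have "((\<lambda>t. \<Prod>j\<in>UNIV. (x + t *\<^sub>R y) $ j ^ ?l e j) has_real_derivative
      (\<Sum>i\<in>UNIV. (real (?l e i) * (y $ i * ?z $ i ^ (?l e i - 1)))
          * (\<Prod>j\<in>UNIV - {i}. ?z $ j ^ ?l e j))) (at t)"
    by (rule has_field_derivative_prod) (auto intro!: derivative_eq_intros)
  from DERIV_cmult[OF this, of c] show ?case
    unfolding peval_single[of e c] monomial_value_def[of e]
    apply (rule DERIV_cong)
    unfolding sum_distrib_left partial_deriv_single peval_single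
    apply (rule sum.cong[OF refl])
    subgoal for i
      using split[of i] by (simp add: algebra_simps)
    done
next
  case (add p q)
  then show ?case
    by (auto intro!: derivative_eq_intros simp: algebra_simps sum.distrib)
qed

section \<open>Gram matrices\<close>

text \<open>A Gram matrix factors as \<open>L L\<^sup>T\<close>. The notion covers at once the factorization in the definition
of SOS-convexity (rows indexed by the variables, entries in the polynomial ring) and sums of
squares (a single row: the index type \<^typ>\<open>unit\<close>), so that both share one set of closure
properties.\<close>

definition gram :: "('a \<Rightarrow> 'a \<Rightarrow> 'r::comm_ring_1) \<Rightarrow> bool" where
  "gram H \<longleftrightarrow> (\<exists>(r::nat) L. \<forall>i j. H i j = (\<Sum>l<r. L i l * L j l))"

lemma gram_zero: "gram (\<lambda>i j. 0)"
  unfolding gram_def by (rule exI[of _ 0]) simp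

lemma gram_rank_one: "gram (\<lambda>i j. v i * v j)"
  unfolding gram_def by (rule exI[of _ 1], rule exI[of _ "\<lambda>i l. v i"]) simp

lemma gram_add:
  fixes H K :: "'a \<Rightarrow> 'a \<Rightarrow> 'b::comm_ring_1"
  assumes "gram H" "gram K"
  shows "gram (\<lambda>i j. H i j + K i j)"
proof -
  obtain r :: nat and L where H: "\<And>i j. H i j = (\<Sum>l<r. L i l * L j l)"
    using assms(1) unfolding gram_def by blast
  obtain s :: nat and M where K: "\<And>i j. K i j = (\<Sum>l<s. M i l * M j l)"
    using assms(2) unfolding gram_def by blast
  \<comment> \<open>The columns of the two factors are put side by side.\<close>
  have split: "(\<Sum>l<r + s. h l) = (\<Sum>l<r. h l) + (\<Sum>l<s. h (r + l))" for h :: "nat \<Rightarrow> 'b"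
    by (induction s) (auto simp: add.assoc)
  define N where "N i l = (if l < r then L i l else M i (l - r))" for i l
  have "H i j + K i j = (\<Sum>l<r + s. N i l * N j l)" for i j
    unfolding split by (simp add: N_def H K)
  then show ?thesis unfolding gram_def by blast
qed

lemma gram_sum:
  "(\<And>a. a \<in> A \<Longrightarrow> gram (H a)) \<Longrightarrow> gram (\<lambda>i j. \<Sum>a\<in>A. H a i j)"
  by (induction A rule: infinite_finite_induct) (auto simp: gram_zero gram_add)

lemma gram_square_mult:
  fixes H :: "'a \<Rightarrow> 'a \<Rightarrow> 'b::comm_ring_1"
  assumes "gram H"
  shows "gram (\<lambda>i j. c * c * H i j)"
proof -
  obtain r :: nat and L where H: "\<And>i j. H i j = (\<Sum>l<r. L i l * L j l)"
    using assms unfolding gram_def by blast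
  have "c * c * H i j = (\<Sum>l<r. (c * L i l) * (c * L j l))" for i j
    by (simp add: H sum_distrib_left algebra_simps)
  then show ?thesis
    unfolding gram_def by (intro exI[of _ r] exI[of _ "\<lambda>i l. c * L i l"]) simp
qed

lemma pconst_mult: "pconst (a * b) = pconst a * pconst b"
  by (rule peval_inject) simp

lemma pconst_sum: "pconst (\<Sum>a\<in>A. h a) = (\<Sum>a\<in>A. pconst (h a))"
  by (rule peval_inject) simp

lemma gram_nonneg_mult:
  fixes H :: "'a \<Rightarrow> 'a \<Rightarrow> 'n::finite rpoly"
  assumes "gram H" "c \<ge> 0"
  shows "gram (\<lambda>i j. pconst c * H i j)"
  using gram_square_mult[OF assms(1), of "pconst (sqrt c)"] assms(2)
  by (simp flip: pconst_mult)

lemma linear_nonneg_imp_zero: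
  fixes a b :: real
  assumes "\<And>t. 0 \<le> b + t * a"
  shows "a = 0"
proof (rule ccontr)
  assume "a \<noteq> 0"
  then show False using assms[of "(- b - 1) / a"] by simp
qed

text \<open>Cholesky factorization by completing the square in one variable \<open>x\<^sub>a\<close> after the other. If the
diagonal entry \<open>A\<^sub>a\<^sub>a\<close> vanishes, then so does its whole row, since the form is affine in \<open>x\<^sub>a\<close> and
bounded below. Otherwise the Schur complement is again positive semidefinite, because its
values are the minima of the form over \<open>x\<^sub>a\<close>, and row \<open>a\<close> contributes one more column.\<close>

lemma psd_factorization:
  fixes A :: "'a \<Rightarrow> 'a \<Rightarrow> real"
  assumes "finite S"
    and "\<And>i j. i \<in> S \<Longrightarrow> j \<in> S \<Longrightarrow> A i j = A j i"
    and "\<And>x. 0 \<le> (\<Sum>i\<in>S. \<Sum>j\<in>S. A i j * x i * x j)"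
  shows "\<exists>(r::nat) L. \<forall>i\<in>S. \<forall>j\<in>S. A i j = (\<Sum>l<r. L i l * L j l)"
  using assms
proof (induction S arbitrary: A rule: finite_induct)
  case (insert a S)
  let ?w = "\<lambda>x. \<Sum>j\<in>S. A a j * x j"
  let ?q = "\<lambda>x. \<Sum>i\<in>S. \<Sum>j\<in>S. A i j * x i * x j"
  have sym: "A i a = A a i" if "i \<in> S" for i
    using insert.prems(1) that by blast
  \<comment> \<open>The form separated into its terms of degree \<open>2\<close>, \<open>1\<close> and \<open>0\<close> in \<open>x a\<close>.\<close>
  have expand: "(\<Sum>i\<in>insert a S. \<Sum>j\<in>insert a S. A i j * x i * x j)
      = A a a * (x a)\<^sup>2 + 2 * x a * ?w x + ?q x" for x
  proof -
    have 1: "(\<Sum>i\<in>S. A i a * x i * x a) = x a * ?w x"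
      unfolding sum_distrib_left by (rule sum.cong) (auto simp: sym)
    have 2: "(\<Sum>j\<in>S. A a j * x a * x j) = x a * ?w x"
      unfolding sum_distrib_left by (rule sum.cong) auto
    have "(\<Sum>i\<in>insert a S. \<Sum>j\<in>insert a S. A i j * x i * x j)
      = A a a * x a * x a + (\<Sum>j\<in>S. A a j * x a * x j) + ((\<Sum>i\<in>S. A i a * x i * x a) + ?q x)"
      using insert.hyps by (simp add: sum.distrib)
    then show ?thesis unfolding 1 2 by (simp add: power2_eq_square)
  qed
  have nonneg: "0 \<le> A a a * s\<^sup>2 + 2 * s * ?w x + ?q x" for s x
  proof -
    have "?w (x(a := s)) = ?w x" "?q (x(a := s)) = ?q x"
      using insert.hyps by (auto intro!: sum.cong)
    then show ?thesis
      using insert.prems(2)[of "x(a := s)"] unfolding expand by simp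
  qed
  have diag: "0 \<le> A a a" using nonneg[of 1 "\<lambda>_. 0"] by simp
  show ?case
  proof (cases "A a a = 0")
    case True
    have row: "A a j = 0" if "j \<in> S" for j
    proof -
      let ?e = "\<lambda>i. if i = j then 1 else (0::real)"
      have "?w ?e = A a j"
        using that insert.hyps by (simp add: if_distrib cong: if_cong)
      then have "0 \<le> ?q ?e + t * (2 * A a j)" for t
        using nonneg[of t ?e] True by (simp add: algebra_simps)
      from linear_nonneg_imp_zero[OF this] show ?thesis by simp
    qed
    have "0 \<le> ?q x" for x using nonneg[of 0 x] by simp
    then obtain r :: nat and L where L: "\<And>i j. i \<in> S \<Longrightarrow> j \<in> S \<Longrightarrow> A i j = (\<Sum>l<r. L i l * L j l)"
      using insert.IH[of A] insert.prems(1) by blast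
    define N where "N i l = (if i = a then 0 else L i l)" for i l
    have "A i j = (\<Sum>l<r. N i l * N j l)" if "i \<in> insert a S" "j \<in> insert a S" for i j
    proof (cases "i = a \<or> j = a")
      case True
      with \<open>A a a = 0\<close> show ?thesis using that row sym by (auto simp: N_def)
    next
      case False
      then show ?thesis using that L by (auto simp: N_def)
    qed
    then show ?thesis by blast
  next
    case False
    \<comment> \<open>Columns \<open>l < r\<close> factor the Schur complement \<open>B\<close>; the last column \<open>l = r\<close> is the new one.\<close>
    define c where "c = A a a"
    have c: "c > 0" using False diag by (simp add: c_def)
    define B where "B i j = A i j - A a i * A a j / c" for i j
    have "0 \<le> (\<Sum>i\<in>S. \<Sum>j\<in>S. B i j * x i * x j)" for x
    proof -
      have "(\<Sum>i\<in>S. \<Sum>j\<in>S. B i j * x i * x j) = ?q x - (\<Sum>i\<in>S. \<Sum>j\<in>S. (A a i * x i) * (A a j * x j)) / c"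
        by (simp add: B_def algebra_simps sum_subtractf sum_divide_distrib)
      also have "\<dots> = ?q x - (?w x)\<^sup>2 / c"
        by (simp add: sum_product power2_eq_square)
      also have "\<dots> = c * (- ?w x / c)\<^sup>2 + 2 * (- ?w x / c) * ?w x + ?q x"
        using c by (simp add: field_simps power2_eq_square)
      also have "\<dots> \<ge> 0" using nonneg[of "- ?w x / c" x] by (simp add: c_def)
      finally show ?thesis .
    qed
    moreover have "B i j = B j i" if "i \<in> S" "j \<in> S" for i j
      using insert.prems(1)[of i j] that by (simp add: B_def)
    ultimately obtain r :: nat and L
      where L: "\<And>i j. i \<in> S \<Longrightarrow> j \<in> S \<Longrightarrow> B i j = (\<Sum>l<r. L i l * L j l)"
      using insert.IH[of B] by blast
    define N where "N i l = (if l < r then (if i = a then 0 else L i l) else A a i / sqrt c)" for i l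
    have sum_N: "(\<Sum>l<Suc r. N i l * N j l) = 
        (\<Sum>l<r. (if i = a then 0 else L i l) * (if j = a then 0 else L j l)) + A a i * A a j / c" for i j
      using c by (simp add: N_def)
    have "A i j = (\<Sum>l<Suc r. N i l * N j l)" if "i \<in> insert a S" "j \<in> insert a S" for i j
    proof (cases "i = a \<or> j = a")
      case True
      then show ?thesis unfolding sum_N using that sym c by (auto simp flip: c_def)
    next
      case False
      then show ?thesis unfolding sum_N using that L[of i j] by (simp add: B_def)
    qed
    then show ?thesis by blast
  qed
qed simp

text \<open>A positive semidefinite real quadratic form is a sum of squares of linear forms, and this
identity persists when polynomials are substituted for the variables.\<close>

lemma gram_psd_contraction:
  fixes M :: "'a \<Rightarrow> 'a \<Rightarrow> real" and P :: "'a \<Rightarrow> 'n::finite rpoly"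
  assumes "finite S"
    and "\<And>i j. i \<in> S \<Longrightarrow> j \<in> S \<Longrightarrow> M i j = M j i"
    and "\<And>x. 0 \<le> (\<Sum>i\<in>S. \<Sum>j\<in>S. M i j * x i * x j)"
  shows "gram (\<lambda>(_::unit) _. \<Sum>i\<in>S. \<Sum>j\<in>S. pconst (M i j) * P i * P j)"
proof -
  obtain r :: nat and L where L: "\<And>i j. i \<in> S \<Longrightarrow> j \<in> S \<Longrightarrow> M i j = (\<Sum>l<r. L i l * L j l)"
    using psd_factorization[of S M] assms by blast
  let ?h = "\<lambda>l. \<Sum>i\<in>S. pconst (L i l) * P i"
  have "(\<Sum>i\<in>S. \<Sum>j\<in>S. pconst (M i j) * P i * P j)
      = (\<Sum>i\<in>S. \<Sum>j\<in>S. \<Sum>l<r. (pconst (L i l) * P i) * (pconst (L j l) * P j))"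
    by (intro sum.cong refl) (simp add: L pconst_sum pconst_mult sum_distrib_left sum_distrib_right mult_ac)
  also have "\<dots> = (\<Sum>i\<in>S. \<Sum>l<r. \<Sum>j\<in>S. (pconst (L i l) * P i) * (pconst (L j l) * P j))"
    by (intro sum.cong refl sum.swap)
  also have "\<dots> = (\<Sum>l<r. \<Sum>i\<in>S. \<Sum>j\<in>S. (pconst (L i l) * P i) * (pconst (L j l) * P j))"
    by (rule sum.swap)
  also have "\<dots> = (\<Sum>l<r. ?h l * ?h l)"
    by (simp add: sum_product)
  finally show ?thesis
    unfolding gram_def by (intro exI[of _ r] exI[of _ "\<lambda>_. ?h"]) simp
qed

section \<open>Taylor expansion of SOS-convex polynomials\<close>

text \<open>The value of \<open>\<integral> (1 - t) t\<^sup>n dt\<close> over the unit interval, which is what a term \<open>t\<^sup>n\<close> of the second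
derivative contributes to the remainder of a first-order Taylor expansion. Only polynomials in
\<open>t\<close> occur, so explicit antiderivatives take the place of the integral.\<close>

definition remainder_weight :: "nat \<Rightarrow> real" where
  "remainder_weight n = 1 / (real (n + 1) * real (n + 2))"

lemma second_antiderivative:
  fixes c :: "'s \<Rightarrow> real" and n :: "'s \<Rightarrow> nat"
  shows "((\<lambda>t. \<Sum>s\<in>I. c s * remainder_weight (n s) * t ^ (n s + 2)) has_real_derivative
           (\<Sum>s\<in>I. c s * t ^ (n s + 1) / real (n s + 1))) (at t)"
    and "((\<lambda>t. \<Sum>s\<in>I. c s * t ^ (n s + 1) / real (n s + 1)) has_real_derivative
           (\<Sum>s\<in>I. c s * t ^ n s)) (at t)"
proof -
  have w: "remainder_weight k * (real (k + 2) * u) = u / real (k + 1)" for k u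
    by (simp add: remainder_weight_def field_simps del: of_nat_Suc of_nat_add)
  have "((\<lambda>t. c s * remainder_weight (n s) * t ^ (n s + 2)) has_real_derivative
      c s * (remainder_weight (n s) * (real (n s + 2) * t ^ (n s + 1)))) (at t)" for s
    by (rule DERIV_cong, (rule derivative_intros)+) (simp add: algebra_simps)
  then show "((\<lambda>t. \<Sum>s\<in>I. c s * remainder_weight (n s) * t ^ (n s + 2)) has_real_derivative
           (\<Sum>s\<in>I. c s * t ^ (n s + 1) / real (n s + 1))) (at t)"
    unfolding w by (intro DERIV_sum) simp
  have "((\<lambda>t. c s * t ^ (n s + 1) / real (n s + 1)) has_real_derivative c s * t ^ n s) (at t)" for s
    by (rule DERIV_cong[OF DERIV_cdivide[OF DERIV_cmult[OF DERIV_pow]]]) simp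
  then show "((\<lambda>t. \<Sum>s\<in>I. c s * t ^ (n s + 1) / real (n s + 1)) has_real_derivative
           (\<Sum>s\<in>I. c s * t ^ n s)) (at t)"
    by (intro DERIV_sum)
qed

text \<open>The functional given by the weights is positive: it maps a polynomial to the value at \<open>1\<close> of the
second antiderivative that vanishes to first order at \<open>0\<close>, and this antiderivative is
nondecreasing on the positive axis if the polynomial is nonnegative.\<close>

lemma remainder_weight_sum_nonneg:
  fixes c :: "'s \<Rightarrow> real"
  assumes "\<And>t. 0 \<le> (\<Sum>s\<in>I. c s * t ^ n s)"
  shows "0 \<le> (\<Sum>s\<in>I. c s * remainder_weight (n s))"
proof -
  let ?G = "\<lambda>t. \<Sum>s\<in>I. c s * remainder_weight (n s) * t ^ (n s + 2)"
  let ?G' = "\<lambda>t. \<Sum>s\<in>I. c s * t ^ (n s + 1) / real (n s + 1)"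
  have G': "0 \<le> ?G' t" if "0 \<le> t" for t
  proof -
    have "?G' 0 \<le> ?G' t"
      using that second_antiderivative(2)[where I = I and c = c and n = n] assms
      by (intro DERIV_nonneg_imp_nondecreasing[where f = ?G']) blast+
    then show ?thesis by simp
  qed
  have "?G 0 \<le> ?G 1"
    using second_antiderivative(1)[where I = I and c = c and n = n] G'
    by (intro DERIV_nonneg_imp_nondecreasing[where f = ?G]) (simp, blast)
  then show ?thesis by simp
qed

text \<open>Taylor expansion at a critical point: \<open>\<phi>\<close> and the explicit second antiderivative of the second
derivative of \<open>\<phi>\<close> have the same first two derivatives, so they differ by a constant.\<close>

lemma second_order_taylor_weights:
  fixes c :: "'s \<Rightarrow> real"
  assumes \<phi>: "\<And>t. (\<phi> has_real_derivative \<phi>' t) (at t)"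
    and \<phi>': "\<And>t. (\<phi>' has_real_derivative (\<Sum>s\<in>I. c s * t ^ n s)) (at t)"
    and crit: "\<phi>' 0 = 0"
  shows "\<phi> 1 = \<phi> 0 + (\<Sum>s\<in>I. c s * remainder_weight (n s))"
proof -
  let ?G = "\<lambda>t. \<Sum>s\<in>I. c s * remainder_weight (n s) * t ^ (n s + 2)"
  let ?G' = "\<lambda>t. \<Sum>s\<in>I. c s * t ^ (n s + 1) / real (n s + 1)"
  have "((\<lambda>t. \<phi>' t - ?G' t) has_real_derivative 0) (at t)" for t
    using DERIV_diff[OF \<phi>'[of t] second_antiderivative(2)[where I = I and c = c and n = n]] by simp
  then have "\<phi>' t - ?G' t = \<phi>' 0 - ?G' 0" for t
    using DERIV_isconst_all[of "\<lambda>t. \<phi>' t - ?G' t" t 0] by blast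
  then have eq: "\<phi>' t = ?G' t" for t using crit by simp
  have "((\<lambda>t. \<phi> t - ?G t) has_real_derivative 0) (at t)" for t
    using DERIV_diff[OF \<phi>[of t] second_antiderivative(1)[where I = I and c = c and n = n]]
    by (simp add: eq)
  then have "\<phi> 1 - ?G 1 = \<phi> 0 - ?G 0"
    using DERIV_isconst_all[of "\<lambda>t. \<phi> t - ?G t" 1 0] by blast
  then show ?thesis by simp
qed

text \<open>The polynomial \<open>p (z + t (x - z))\<close>, as a polynomial in \<open>t\<close> whose coefficients are polynomials
in \<open>x\<close>: its coefficients are what remains when \<open>t\<close> is integrated out. Substituting the constant
polynomial \<open>t\<close> and then evaluating at \<open>x\<close> are ring homomorphisms, which yields the values of
\<open>p\<close> on the line through \<open>z\<close> and \<open>x\<close>.\<close>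

definition line_poly :: "real ^ 'n::finite \<Rightarrow> 'n rpoly \<Rightarrow> 'n rpoly poly" where
  "line_poly z p = (\<Sum>e\<in>Poly_Mapping.keys p. [:pconst (Poly_Mapping.lookup p e):] *
     (\<Prod>i\<in>UNIV. [:pconst (z $ i), pvar i - pconst (z $ i):] ^ Poly_Mapping.lookup e i))"

lemma peval_line_poly:
  "peval (poly (line_poly z p) (pconst t)) x = peval p (z + t *\<^sub>R (x - z))"
  unfolding line_poly_def peval_def[of p] by (simp add: poly_sum poly_prod)

lemma peval_poly_expansion:
  "peval (poly Q (pconst t)) x = (\<Sum>a\<le>degree Q. peval (coeff Q a) x * t ^ a)"
  by (simp add: poly_altdef)

text \<open>The remainder at a critical point \<open>z\<close> is \<open>F x - F z = \<integral> (1 - t) y\<^sup>T H(z + t y) y dt\<close> over the unit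
interval, with \<open>y = x - z\<close>. With \<open>H = L L\<^sup>T\<close> the integrand becomes \<open>(1 - t)\<close> times a sum of squares
of polynomials \<open>Q l\<close> in \<open>t\<close> and \<open>x\<close>. Integrating out \<open>t\<close> turns each square into a quadratic form
in the \<open>t\<close>-coefficients \<open>P l a\<close>; its matrix is the moment matrix of the weight \<open>1 - t\<close>, which is
positive semidefinite, so the result is a sum of squares in \<open>x\<close>.\<close>

lemma gram_diff_at_critical_point:
  fixes F :: "'n::finite rpoly"
  assumes hess: "gram (hessian F)"
    and crit: "\<And>i. peval (partial_deriv i F) z = 0"
  shows "gram (\<lambda>(_::unit) _. F - pconst (peval F z))"
proof -
  obtain r :: nat and L where L: "\<And>i j. hessian F i j = (\<Sum>l<r. L i l * L j l)"
    using hess unfolding gram_def by blast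
  define Q where "Q l = (\<Sum>i\<in>UNIV. [:pvar i - pconst (z $ i):] * line_poly z (L i l))" for l
  define D where "D l = degree (Q l)" for l
  define P where "P l = coeff (Q l)" for l
  define W where "W = (\<Sum>l<r. \<Sum>a\<in>{..D l}. \<Sum>b\<in>{..D l}. pconst (remainder_weight (a + b)) * P l a * P l b)"
  have square: "(\<Sum>a\<le>d. u a * t ^ a)\<^sup>2 = (\<Sum>(a, b)\<in>{..d} \<times> {..d}. (u a * u b) * t ^ (a + b))"
    for u :: "nat \<Rightarrow> real" and t d
    unfolding power2_eq_square sum_product sum.cartesian_product
    by (rule sum.cong) (auto simp: power_add algebra_simps)
  have "gram (\<lambda>(_::unit) _. \<Sum>a\<in>{..D l}. \<Sum>b\<in>{..D l}. pconst (remainder_weight (a + b)) * P l a * P l b)" for l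
  proof (rule gram_psd_contraction)
    fix u :: "nat \<Rightarrow> real"
    have "0 \<le> (\<Sum>s\<in>{..D l} \<times> {..D l}. (u (fst s) * u (snd s)) * t ^ (fst s + snd s))" for t
      using square[of u t "D l"] by (simp add: case_prod_unfold) (metis zero_le_power2)
    from remainder_weight_sum_nonneg[OF this]
    show "0 \<le> (\<Sum>i\<le>D l. \<Sum>j\<le>D l. remainder_weight (i + j) * u i * u j)"
      by (simp add: sum.cartesian_product case_prod_unfold algebra_simps)
  qed (auto simp: add.commute)
  then have "gram (\<lambda>(_::unit) _. W)"
    unfolding W_def by (rule gram_sum)
  moreover have "F - pconst (peval F z) = W"
  proof (rule peval_inject)
    fix x
    define y where "y = x - z"
    define I where "I = (SIGMA l:{..<r}. {..D l} \<times> {..D l})"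
    define c where "c = (\<lambda>(l, a, b). peval (P l a) x * peval (P l b) x)"
    define n :: "nat \<times> nat \<times> nat \<Rightarrow> nat" where "n = (\<lambda>(l, a, b). a + b)"
    let ?\<phi> = "\<lambda>t. peval F (z + t *\<^sub>R y)"
    let ?\<phi>' = "\<lambda>t. \<Sum>i\<in>UNIV. y $ i * peval (partial_deriv i F) (z + t *\<^sub>R y)"
    have Q: "(\<Sum>i\<in>UNIV. y $ i * peval (L i l) (z + t *\<^sub>R y)) = (\<Sum>a\<le>D l. peval (P l a) x * t ^ a)" for l t
      unfolding D_def P_def peval_poly_expansion[symmetric]
      by (simp add: Q_def poly_sum peval_line_poly y_def)
    have "(\<Sum>i\<in>UNIV. y $ i * (\<Sum>j\<in>UNIV. y $ j * peval (partial_deriv j (partial_deriv i F)) (z + t *\<^sub>R y)))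
       = (\<Sum>s\<in>I. c s * t ^ n s)" for t
    proof -
      let ?v = "\<lambda>i l. y $ i * peval (L i l) (z + t *\<^sub>R y)"
      have "(\<Sum>i\<in>UNIV. y $ i * (\<Sum>j\<in>UNIV. y $ j * peval (partial_deriv j (partial_deriv i F)) (z + t *\<^sub>R y)))
         = (\<Sum>i\<in>UNIV. \<Sum>j\<in>UNIV. \<Sum>l<r. ?v i l * ?v j l)"
        by (simp add: hessian_def[symmetric] L sum_distrib_left algebra_simps)
      also have "\<dots> = (\<Sum>i\<in>UNIV. \<Sum>l<r. \<Sum>j\<in>UNIV. ?v i l * ?v j l)"
        by (intro sum.cong refl sum.swap)
      also have "\<dots> = (\<Sum>l<r. \<Sum>i\<in>UNIV. \<Sum>j\<in>UNIV. ?v i l * ?v j l)"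
        by (rule sum.swap)
      also have "\<dots> = (\<Sum>l<r. (\<Sum>i\<in>UNIV. ?v i l)\<^sup>2)"
        by (simp add: sum_product power2_eq_square)
      also have "\<dots> = (\<Sum>l<r. \<Sum>s\<in>{..D l} \<times> {..D l}. c (l, s) * t ^ n (l, s))"
        unfolding Q square by (simp add: c_def n_def case_prod_unfold)
      also have "\<dots> = (\<Sum>s\<in>I. c s * t ^ n s)"
        unfolding I_def by (subst sum.Sigma) (auto simp: case_prod_unfold)
      finally show ?thesis .
    qed
    then have "(?\<phi>' has_real_derivative (\<Sum>s\<in>I. c s * t ^ n s)) (at t)" for t
      using DERIV_sum[of UNIV "\<lambda>t i. y $ i * peval (partial_deriv i F) (z + t *\<^sub>R y)", OF DERIV_cmult[OF peval_line_derivative]]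
      by (metis (no_types, lifting))
    then have "?\<phi> 1 = ?\<phi> 0 + (\<Sum>s\<in>I. c s * remainder_weight (n s))"
      by (intro second_order_taylor_weights[where \<phi>' = ?\<phi>'] peval_line_derivative) (auto simp: crit)
    also have "(\<Sum>s\<in>I. c s * remainder_weight (n s))
        = (\<Sum>l<r. \<Sum>s\<in>{..D l} \<times> {..D l}. c (l, s) * remainder_weight (n (l, s)))"
      unfolding I_def by (subst sum.Sigma) (auto simp: case_prod_unfold)
    also have "\<dots> = peval W x"
      by (simp add: W_def c_def n_def sum.cartesian_product case_prod_unfold algebra_simps)
    finally show "peval (F - pconst (peval F z)) x = peval W x"
      by (simp add: y_def)
  qed
  ultimately show ?thesis by simp
qed

section \<open>Convex polynomials attain their minimum\<close>

text \<open>A nonconstant polynomial is \<open>a + t q(t)\<close> with \<open>q \<noteq> 0\<close>, and one of \<open>q\<close> and \<open>- q\<close> is eventually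
bounded below by its positive leading coefficient, so that the product with \<open>t\<close> is unbounded.\<close>

lemma bounded_poly_imp_const:
  fixes p :: "real poly"
  assumes "\<And>t. t \<ge> 0 \<Longrightarrow> \<bar>poly p t\<bar> \<le> M"
  shows "degree p = 0"
proof -
  have no: False if q_pos: "lead_coeff q > 0" and q_le: "\<And>t. t \<ge> 0 \<Longrightarrow> poly (pCons a q) t \<le> M" for a and q :: "real poly"
  proof -
    obtain n where n: "\<And>x. x \<ge> n \<Longrightarrow> poly q x \<ge> lead_coeff q"
      using poly_pinfty_gt_lc[OF q_pos] by blast
    define t where "t = max (max n 0) ((M - a + 1) / lead_coeff q)"
    have "M - a + 1 \<le> t * lead_coeff q"
      using q_pos by (simp add: t_def pos_divide_le_eq[symmetric])
    also have "\<dots> \<le> t * poly q t"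
      using n[of t] by (intro mult_left_mono) (auto simp: t_def)
    moreover have "t \<ge> 0" by (simp add: t_def)
    ultimately show False using q_le[of t] by simp
  qed
  obtain a q where p: "p = pCons a q" by (cases p) auto
  have "q = 0"
  proof (rule ccontr)
    assume "q \<noteq> 0"
    then consider "lead_coeff q > 0" | "lead_coeff (- q) > 0"
      by (metis coeff_minus degree_minus leading_coeff_0_iff linorder_neqE_linordered_idom neg_0_less_iff_less)
    then show False
    proof cases
      case 1
      then show ?thesis using no[of q a] assms unfolding p by (meson abs_le_D1)
    next
      case 2
      have "poly (pCons (- a) (- q)) t \<le> M" if "t \<ge> 0" for t
        using assms[OF that] unfolding p by (simp add: abs_le_iff)
      then show ?thesis using no[of "- q" "- a"] 2 by simp
    qed
  qed
  then show ?thesis by (simp add: p)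
qed

lemma peval_line_is_poly:
  "\<exists>P. \<forall>t. peval p (x + t *\<^sub>R v) = poly P t"
proof
  show "\<forall>t. peval p (x + t *\<^sub>R v) = poly (\<Sum>e\<in>Poly_Mapping.keys p. [:Poly_Mapping.lookup p e:] *
     (\<Prod>i\<in>UNIV. [:x $ i, v $ i:] ^ Poly_Mapping.lookup e i)) t"
    by (simp add: peval_def poly_sum poly_prod)
qed

lemma peval_constant_on_line:
  assumes "\<And>t. t \<ge> 0 \<Longrightarrow> m \<le> peval p (x + t *\<^sub>R v) \<and> peval p (x + t *\<^sub>R v) \<le> M"
  shows "peval p (x + t *\<^sub>R v) = peval p x"
proof -
  obtain P where P: "\<And>t. peval p (x + t *\<^sub>R v) = poly P t"
    using peval_line_is_poly by blast
  have "\<bar>poly P t\<bar> \<le> max \<bar>m\<bar> \<bar>M\<bar>" if "t \<ge> 0" for t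
    using assms[OF that] unfolding P by auto
  then have "degree P = 0" by (rule bounded_poly_imp_const)
  then have "poly P t = poly P 0" by (elim degree_eq_zeroE) simp
  then show ?thesis using P[of 0] P[of t] by simp
qed

lemma convex_on_UNIV_combination:
  assumes "convex_on UNIV k" "0 \<le> a" "0 \<le> b" "a + b = 1"
  shows "k (a *\<^sub>R x + b *\<^sub>R y) \<le> a * k x + b * k y"
  using assms unfolding convex_on_def by blast

text \<open>Convex functions that are bounded below, such as \<open>exp\<close>, need not attain their infimum; polynomials
do. Take the points \<open>X n\<close> of minimal norm in the sublevel sets at heights decreasing to
the infimum. If they are bounded, a limit point is a minimizer. Otherwise, let \<open>v\<close> be a limit of
their directions. Convexity bounds \<open>F\<close> from above along every ray in direction \<open>v\<close>, and a
polynomial in one variable that is bounded on a half-line is constant, so \<open>F\<close> is invariant under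
translation by \<open>v\<close>. But then \<open>X n - v\<close> lies in the same sublevel set as \<open>X n\<close> and, for large
\<open>n\<close>, is closer to the origin: a contradiction.\<close>

lemma convex_poly_bounded_below_attains_min:
  fixes F :: "'n::finite rpoly"
  assumes conv: "convex_on UNIV (peval F)" and lower: "\<And>x. m \<le> peval F x"
  shows "\<exists>z. \<forall>x. peval F z \<le> peval F x"
proof -
  define m0 where "m0 = Inf (range (peval F))"
  have bdd: "bdd_below (range (peval F))" using lower by (intro bdd_belowI[of _ m]) auto
  have m0: "m0 \<le> peval F x" for x
    unfolding m0_def using bdd by (intro cInf_lower) auto
  define S where "S n = {x. peval F x \<le> m0 + 1 / real (Suc n)}" for n
  have "\<exists>x\<in>S n. \<forall>y\<in>S n. norm x \<le> norm y" for n
  proof -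
    have "m0 < m0 + 1 / real (Suc n)" by simp
    then obtain x where "peval F x < m0 + 1 / real (Suc n)"
      using cInf_lessD[of "range (peval F)"] unfolding m0_def by blast
    then have ne: "S n \<noteq> {}" unfolding S_def by (auto intro: less_imp_le)
    have "closed (S n)"
      unfolding S_def by (intro closed_Collect_le continuous_on_peval continuous_on_const)
    then obtain x where "x \<in> S n" "\<And>y. y \<in> S n \<Longrightarrow> dist 0 x \<le> dist 0 y"
      using distance_attains_inf[OF _ ne, of 0] by blast
    then show ?thesis by auto
  qed
  then obtain X where XS: "\<And>n. X n \<in> S n" and Xmin: "\<And>n y. y \<in> S n \<Longrightarrow> norm (X n) \<le> norm y"
    by metis
  have X_le: "peval F (X n) \<le> m0 + 1 / real (Suc n)" for n
    using XS[of n] by (simp add: S_def)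
  have "S k \<subseteq> S n" if "n \<le> k" for n k
    unfolding S_def using that by (auto intro: order_trans simp: frac_le)
  then have mono: "norm (X n) \<le> norm (X k)" if "n \<le> k" for n k
    using Xmin XS that by blast
  show ?thesis
  proof (cases "bounded (range X)")
    case True
    then obtain z r where r: "strict_mono (r :: nat \<Rightarrow> nat)" and z: "(X \<circ> r) \<longlonglongrightarrow> z"
      using bounded_imp_convergent_subsequence by blast
    have "(\<lambda>n. peval F ((X \<circ> r) n)) \<longlonglongrightarrow> peval F z"
      using continuous_on_tendsto_compose[OF continuous_on_peval[of UNIV F] z] by simp
    moreover have "(\<lambda>n. m0 + 1 / real (Suc (r n))) \<longlonglongrightarrow> m0 + 0"
      using LIMSEQ_subseq_LIMSEQ[OF LIMSEQ_inverse_real_of_nat r]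
      by (intro tendsto_intros) (simp add: o_def inverse_eq_divide)
    ultimately have "peval F z \<le> m0"
      using X_le by (intro LIMSEQ_le[where X = "\<lambda>n. peval F ((X \<circ> r) n)"]) auto
    then show ?thesis using m0 order_trans by blast
  next
    case False
    have large: "\<forall>\<^sub>F n in sequentially. K \<le> norm (X n)" for K
    proof -
      obtain n where "K < norm (X n)"
        using False unfolding bounded_iff by (auto simp: not_le)
      then show ?thesis
        unfolding eventually_sequentially using mono by (intro exI[of _ n]) (meson less_imp_le order_trans)
    qed
    define y where "y n = X n /\<^sub>R norm (X n)" for n
    have "norm (y n) \<le> 1" for n by (cases "X n = 0") (auto simp: y_def)
    then have "bounded (range y)" unfolding bounded_iff by blast
    then obtain v r where r: "strict_mono (r :: nat \<Rightarrow> nat)" and v: "(y \<circ> r) \<longlonglongrightarrow> v"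
      using bounded_imp_convergent_subsequence by blast
    have larger: "\<forall>\<^sub>F n in sequentially. K \<le> norm (X (r n))" for K
      using eventually_subseq[OF r large[of K]] .
    have unit: "\<forall>\<^sub>F n in sequentially. norm ((y \<circ> r) n) = 1"
      using larger[of 1]
    proof eventually_elim
      case (elim n)
      then have "X (r n) \<noteq> 0" by auto
      then show ?case by (simp add: y_def)
    qed
    have norm_v: "norm v = 1"
      by (rule LIMSEQ_unique[OF tendsto_norm[OF v] tendsto_eventually[OF unit]])
    have inv: "peval F (x + t *\<^sub>R v) = peval F x" for x t
    proof (rule peval_constant_on_line)
      fix t :: real assume t: "t \<ge> 0"
      \<comment> \<open>The points \<open>w n\<close> lie on the segments from \<open>x\<close> to \<open>X (r n)\<close> and converge to \<open>x + t v\<close>.\<close>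
      define \<tau> where "\<tau> n = t / norm (X (r n))" for n
      define w where "w n = (1 - \<tau> n) *\<^sub>R x + \<tau> n *\<^sub>R X (r n)" for n
      have "filterlim (\<lambda>n. norm (X (r n))) at_top sequentially"
        unfolding filterlim_at_top using larger by blast
      then have \<tau>: "\<tau> \<longlonglongrightarrow> 0"
        unfolding \<tau>_def by (intro tendsto_divide_0[OF tendsto_const]) (rule filterlim_at_top_imp_at_infinity)
      have "w = (\<lambda>n. (1 - \<tau> n) *\<^sub>R x + t *\<^sub>R (y \<circ> r) n)"
        by (simp add: w_def \<tau>_def y_def fun_eq_iff divide_inverse)
      moreover have "(\<lambda>n. (1 - \<tau> n) *\<^sub>R x + t *\<^sub>R (y \<circ> r) n) \<longlonglongrightarrow> (1 - 0) *\<^sub>R x + t *\<^sub>R v"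
        by (intro tendsto_intros \<tau> v)
      ultimately have "w \<longlonglongrightarrow> x + t *\<^sub>R v" by simp
      then have lim: "(\<lambda>n. peval F (w n)) \<longlonglongrightarrow> peval F (x + t *\<^sub>R v)"
        using continuous_on_tendsto_compose[OF continuous_on_peval[of UNIV F]] by simp
      have "\<forall>\<^sub>F n in sequentially. peval F (w n) \<le> max (peval F x) (m0 + 1)"
        using larger[of "max 1 t"]
      proof eventually_elim
        case (elim n)
        have \<tau>01: "0 \<le> \<tau> n" "\<tau> n \<le> 1" using elim t by (auto simp: \<tau>_def divide_simps)
        have "peval F (X (r n)) \<le> m0 + 1"
          using X_le[of "r n"] by (rule order_trans) simp
        then have "(1 - \<tau> n) * peval F x + \<tau> n * peval F (X (r n)) \<le> max (peval F x) (m0 + 1)"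
          using \<tau>01 by (intro convex_bound_le) auto
        then show ?case
          unfolding w_def
          using convex_on_UNIV_combination[OF conv, of "1 - \<tau> n" "\<tau> n" x "X (r n)"] \<tau>01 by simp
      qed
      then have "peval F (x + t *\<^sub>R v) \<le> max (peval F x) (m0 + 1)"
        using tendsto_upperbound[OF lim] by simp
      then show "m0 \<le> peval F (x + t *\<^sub>R v) \<and> peval F (x + t *\<^sub>R v) \<le> max (peval F x) (m0 + 1)"
        using m0 by simp
    qed
    have "(\<lambda>n. (y \<circ> r) n \<bullet> v) \<longlonglongrightarrow> v \<bullet> v" by (intro tendsto_intros v)
    then have "\<forall>\<^sub>F n in sequentially. (y \<circ> r) n \<bullet> v > 1 / 2"
      using norm_v by (intro order_tendstoD(1)) (auto simp: dot_square_norm)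
    from eventually_happens'[OF sequentially_bot eventually_conj[OF this larger[of 1]]]
    obtain n where n: "(y \<circ> r) n \<bullet> v > 1 / 2" "1 \<le> norm (X (r n))" by blast
    let ?x = "X (r n)"
    have "?x \<noteq> 0" using n(2) by auto
    then have "?x \<bullet> v = norm ?x * ((y \<circ> r) n \<bullet> v)"
      by (simp add: y_def)
    also have "\<dots> \<ge> 1 * ((y \<circ> r) n \<bullet> v)"
      using n by (intro mult_right_mono) auto
    finally have big: "?x \<bullet> v > 1 / 2" using n(1) by simp
    have "?x - v \<in> S (r n)"
      using XS[of "r n"] inv[of ?x "- 1"] by (simp add: S_def)
    then have "norm ?x \<le> norm (?x - v)" by (rule Xmin)
    then have "(norm ?x)\<^sup>2 \<le> (norm (?x - v))\<^sup>2" by (intro power_mono) auto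
    also have "\<dots> = (norm ?x)\<^sup>2 - 2 * (?x \<bullet> v) + 1"
      using norm_v by (simp add: power2_norm_eq_inner inner_diff algebra_simps inner_commute norm_eq_1)
    finally show ?thesis using big by simp
  qed
qed

lemma partial_deriv_zero_at_min:
  fixes F :: "'n::finite rpoly"
  assumes "\<And>x. peval F z \<le> peval F x"
  shows "peval (partial_deriv i F) z = 0"
proof -
  have "(\<Sum>j\<in>UNIV. axis i 1 $ j * peval (partial_deriv j F) (z + 0 *\<^sub>R axis i 1)) = 0"
    using peval_line_derivative[of F z "axis i 1" 0] assms
    by (intro DERIV_local_min[of _ _ 0 1]) auto
  then show ?thesis by (simp add: axis_def if_distrib[of "\<lambda>u. u * _"] cong: if_cong)
qed

section \<open>Lagrange multipliers\<close>

lemma convex_on_UNIV_combination_strict: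
  assumes "convex_on UNIV k" "0 \<le> a" "0 \<le> b" "a + b = 1" "k x < p" "k y < q"
  shows "k (a *\<^sub>R x + b *\<^sub>R y) < a * p + b * (q::real)"
proof -
  have "a * k x + b * k y < a * p + b * q"
  proof (cases "a = 0")
    case True
    then show ?thesis using assms by simp
  next
    case False
    then have "a * k x < a * p" "b * k y \<le> b * q" using assms by (auto intro: mult_left_mono)
    then show ?thesis by simp
  qed
  then show ?thesis using convex_on_UNIV_combination[OF assms(1-4), of x y] by linarith
qed

text \<open>Strong Lagrange duality. The set \<open>B\<close> of all strict upper bounds of the constraint values and of
the objective gap \<open>f x - v\<close> is convex and avoids the origin, as \<open>v\<close> is a lower bound of the constrained
problem. A hyperplane separates them; its normal \<open>(p, q)\<close> is nonnegative since \<open>B\<close> is closed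
upwards, and the Slater point rules out \<open>q = 0\<close>. The multipliers are \<open>p / q\<close>.\<close>

lemma slater_multipliers:
  fixes f :: "'a::real_vector \<Rightarrow> real" and h :: "'m::finite \<Rightarrow> 'a \<Rightarrow> real"
  assumes f: "convex_on UNIV f" and h: "\<And>j. convex_on UNIV (h j)"
    and slater: "\<And>j. h j x0 < 0"
    and v: "\<And>x. (\<And>j. h j x \<le> 0) \<Longrightarrow> v \<le> f x"
  shows "\<exists>\<mu>. (\<forall>j. 0 \<le> \<mu> j) \<and> (\<forall>x. v \<le> f x + (\<Sum>j\<in>UNIV. \<mu> j * h j x))"
proof -
  define B :: "((real ^ 'm) \<times> real) set"
    where "B = {(u, r). \<exists>x. (\<forall>j. h j x < u $ j) \<and> f x - v < r}"
  have B_convex: "convex B"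
  proof (rule convexI)
    fix p q and a b :: real
    assume pq: "p \<in> B" "q \<in> B" and ab: "0 \<le> a" "0 \<le> b" "a + b = 1"
    obtain x where x: "\<And>j. h j x < fst p $ j" "f x < snd p + v"
      using pq(1) unfolding B_def by (force simp: algebra_simps)
    obtain y where y: "\<And>j. h j y < fst q $ j" "f y < snd q + v"
      using pq(2) unfolding B_def by (force simp: algebra_simps)
    have "h j (a *\<^sub>R x + b *\<^sub>R y) < a * fst p $ j + b * fst q $ j" for j
      by (rule convex_on_UNIV_combination_strict[OF h ab x(1) y(1)])
    moreover have "f (a *\<^sub>R x + b *\<^sub>R y) < a * (snd p + v) + b * (snd q + v)"
      by (rule convex_on_UNIV_combination_strict[OF f ab x(2) y(2)])
    moreover have "a * (snd p + v) + b * (snd q + v) = a * snd p + b * snd q + v"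
    proof -
      have "a * v + b * v = v" using ab(3) by (metis distrib_right mult_1)
      then show ?thesis by (simp add: algebra_simps)
    qed
    ultimately show "a *\<^sub>R p + b *\<^sub>R q \<in> B"
      unfolding B_def
      by (auto simp: case_prod_unfold intro!: exI[of _ "a *\<^sub>R x + b *\<^sub>R y"])
  qed
  have B_zero: "0 \<notin> B"
  proof
    assume "0 \<in> B"
    then obtain x where "\<And>j. h j x < 0" "f x < v" by (auto simp: B_def zero_prod_def)
    then show False using v[of x] less_imp_le by (metis not_le)
  qed
  obtain c where c: "c \<noteq> 0" "\<And>w. w \<in> B \<Longrightarrow> 0 \<le> c \<bullet> w"
    using separating_hyperplane_set_0[OF B_convex B_zero] by blast
  define p where "p = fst c"
  define q where "q = snd c"
  have sep: "0 \<le> p \<bullet> u + q * r" if "\<And>j. h j x < u $ j" "f x - v < r" for u r x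
  proof -
    have "(u, r) \<in> B" using that unfolding B_def by blast
    from c(2)[OF this] show ?thesis by (simp add: inner_prod_def p_def q_def)
  qed
  define R where "R = max 1 (f x0 - v + 1)"
  have R: "R > 0" "f x0 - v < R" by (auto simp: R_def)
  have q: "0 \<le> q"
  proof -
    have "0 \<le> p \<bullet> 0 + q * R" using slater R(2) by (intro sep[of x0]) simp_all
    then show ?thesis using R(1) by (simp add: zero_le_mult_iff)
  qed
  have p: "0 \<le> p $ j" for j
  proof (rule ccontr)
    assume "\<not> 0 \<le> p $ j"
    then have neg: "p $ j < 0" by simp
    \<comment> \<open>Chosen such that the separating functional takes the value \<open>- 1\<close> at \<open>(s e\<^sub>j, R)\<close>.\<close>
    define s where "s = (q * R + 1) / (- p $ j)"
    have "s \<ge> 0" unfolding s_def using neg q R by (intro divide_nonneg_pos) auto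
    then have "0 \<le> p \<bullet> (s *\<^sub>R axis j 1) + q * R"
      using slater R(2) by (intro sep[of x0]) (simp_all add: axis_def less_le_trans[OF slater])
    then have "0 \<le> s * p $ j + q * R" by (simp add: inner_axis)
    moreover have "s * p $ j = - (q * R + 1)" using neg by (simp add: s_def field_simps)
    ultimately show False by simp
  qed
  have "q \<noteq> 0"
  proof
    assume q0: "q = 0"
    have "0 \<le> p \<bullet> (\<chi> j. h j x0 / 2) + q * R"
      using slater R by (intro sep[of x0]) auto
    then have "0 \<le> (\<Sum>j\<in>UNIV. p $ j * (h j x0 / 2))"
      by (simp add: q0 inner_vec_def)
    then have sum0: "(\<Sum>j\<in>UNIV. p $ j * (- h j x0)) \<le> 0"
      by (simp add: sum_negf sum_divide_distrib[symmetric])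
    have nn: "0 \<le> p $ j * (- h j x0)" for j
      using p[of j] slater[of j] by (intro mult_nonneg_nonneg) auto
    have "(\<Sum>j\<in>UNIV. p $ j * (- h j x0)) = 0"
      using sum0 nn by (intro antisym sum_nonneg) auto
    then have "p $ j * (- h j x0) = 0" for j
      using nn sum_nonneg_eq_0_iff[of UNIV "\<lambda>j. p $ j * (- h j x0)"] by simp
    then have "p = 0" using slater by (auto simp: vec_eq_iff) (metis less_irrefl)
    then show False using c(1) q0 by (simp add: p_def q_def prod_eq_iff)
  qed
  with q have q: "q > 0" by simp
  define \<mu> where "\<mu> j = p $ j / q" for j
  have \<mu>: "0 \<le> \<mu> j" for j using p q by (simp add: \<mu>_def)
  have "v \<le> f x + (\<Sum>j\<in>UNIV. \<mu> j * h j x)" for x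
  proof (rule field_le_epsilon)
    fix e :: real assume e: "e > 0"
    \<comment> \<open>The points of \<open>B\<close> lie strictly above the values at \<open>x\<close>; a slack \<open>d\<close> in each coordinate costs \<open>d s = e\<close>.\<close>
    define s where "s = 1 + (\<Sum>j\<in>UNIV. \<mu> j)"
    have s: "s > 0" unfolding s_def using \<mu> by (intro add_pos_nonneg sum_nonneg) auto
    define d where "d = e / s"
    have d: "d > 0" "d * s = e" using s e by (auto simp: d_def)
    have "0 \<le> p \<bullet> (\<chi> j. h j x + d) + q * (f x - v + d)"
      using d by (intro sep[of x]) auto
    also have "\<dots> = q * ((\<Sum>j\<in>UNIV. \<mu> j * (h j x + d)) + (f x - v + d))"
      using q by (simp add: inner_vec_def \<mu>_def distrib_left sum_distrib_left)
    also have "\<dots> = q * ((\<Sum>j\<in>UNIV. \<mu> j * h j x) + f x - v + d * s)"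
      by (simp add: s_def algebra_simps sum.distrib sum_distrib_left)
    finally show "v \<le> f x + (\<Sum>j\<in>UNIV. \<mu> j * h j x) + e"
      using q d by (simp add: zero_le_mult_iff)
  qed
  with \<mu> show ?thesis by (intro exI[of _ \<mu>]) blast
qed

section \<open>SOS-convex polynomials that are bounded below\<close>

lemma sos_convex_imp_gram_hessian: "sos_convex p \<Longrightarrow> gram (hessian p)"
  unfolding sos_convex_def gram_def by blast

lemma hessian_add: "hessian (p + q) i j = hessian p i j + hessian q i j"
  by (simp add: hessian_def)

lemma hessian_pconst_mult: "hessian (pconst c * p) i j = pconst c * hessian p i j"
  by (simp add: hessian_def partial_deriv_pconst_mult)

lemma hessian_sum: "hessian (\<Sum>a\<in>A. p a) i j = (\<Sum>a\<in>A. hessian (p a) i j)"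
  by (simp add: hessian_def partial_deriv_sum)

text \<open>Convex quadratics are SOS-convex: their Hessian is constant, convexity on the segment from \<open>- y\<close>
to \<open>y\<close> makes it positive semidefinite, and such a real matrix has a Cholesky factorization.\<close>

lemma convex_quadratic_gram_hessian:
  fixes p :: "'n::finite rpoly"
  assumes deg: "total_degree p \<le> 2" and conv: "convex_on UNIV (peval p)"
  shows "gram (hessian p)"
proof -
  have "total_degree (hessian p i j) = 0" for i j
    using total_degree_partial_deriv_le[OF total_degree_partial_deriv_le[of p "Suc 0" j], of i] deg
    by (simp add: hessian_def numeral_2_eq_2)
  then have "\<exists>c. hessian p i j = pconst c" for i j
    by (rule total_degree_0_imp_pconst)
  then obtain A where A: "\<And>i j. hessian p i j = pconst (A i j)" by metis
  have "A i j = A j i" for i j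
    using A[of i j] A[of j i] partial_deriv_commute[of i j p]
    unfolding hessian_def by (metis peval_pconst)
  moreover have "0 \<le> (\<Sum>i\<in>UNIV. \<Sum>j\<in>UNIV. A i j * u i * u j)" for u
  proof -
    define y :: "real ^ 'n" where "y = (\<chi> i. u i)"
    define c where "c = (\<Sum>i\<in>UNIV. \<Sum>j\<in>UNIV. A i j * u i * u j)"
    let ?\<phi> = "\<lambda>t. peval p (0 + t *\<^sub>R y)"
    let ?\<phi>' = "\<lambda>t. \<Sum>i\<in>UNIV. y $ i * peval (partial_deriv i p) (0 + t *\<^sub>R y)"
    have "(?\<phi>' has_real_derivative
        (\<Sum>i\<in>UNIV. y $ i * (\<Sum>j\<in>UNIV. y $ j * peval (partial_deriv j (partial_deriv i p)) (0 + t *\<^sub>R y)))) (at t)" for t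
      by (intro DERIV_sum DERIV_cmult peval_line_derivative)
    moreover have "(\<Sum>i\<in>UNIV. y $ i * (\<Sum>j\<in>UNIV. y $ j * peval (partial_deriv j (partial_deriv i p)) (0 + t *\<^sub>R y))) = c" for t
    proof -
      have "(\<Sum>i\<in>UNIV. y $ i * (\<Sum>j\<in>UNIV. y $ j * peval (partial_deriv j (partial_deriv i p)) (0 + t *\<^sub>R y)))
        = (\<Sum>i\<in>UNIV. \<Sum>j\<in>UNIV. A j i * u j * u i)"
        by (simp add: hessian_def[symmetric] A y_def sum_distrib_left mult_ac)
      also have "\<dots> = c" unfolding c_def by (rule sum.swap)
      finally show ?thesis .
    qed
    ultimately have \<phi>': "(?\<phi>' has_real_derivative c) (at t)" for t by simp
    have "((\<lambda>t. ?\<phi>' t - c * t) has_real_derivative 0) (at t)" for t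
      using DERIV_diff[OF \<phi>'[of t] DERIV_cmult_Id[of c]] by simp
    then have \<phi>'_eq: "?\<phi>' t = ?\<phi>' 0 + c * t" for t
      using DERIV_isconst_all[of "\<lambda>t. ?\<phi>' t - c * t" t 0] by auto
    define b where "b = ?\<phi>' 0"
    have "((\<lambda>t. ?\<phi> t - (b * t + c / 2 * t\<^sup>2)) has_real_derivative ?\<phi>' t - (b + c * t)) (at t)" for t
      by (rule DERIV_diff[OF peval_line_derivative]) (auto intro!: derivative_eq_intros)
    then have "((\<lambda>t. ?\<phi> t - (b * t + c / 2 * t\<^sup>2)) has_real_derivative 0) (at t)" for t
      by (rule DERIV_cong) (use \<phi>'_eq in \<open>simp add: b_def\<close>)
    then have \<phi>_eq: "?\<phi> t = ?\<phi> 0 + (b * t + c / 2 * t\<^sup>2)" for t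
      using DERIV_isconst_all[of "\<lambda>t. ?\<phi> t - (b * t + c / 2 * t\<^sup>2)" t 0] by auto
    \<comment> \<open>Convexity at the midpoint of \<open>- y\<close> and \<open>y\<close> cancels the linear term and leaves \<open>c / 2 \<ge> 0\<close>.\<close>
    have "?\<phi> 0 \<le> 1 / 2 * ?\<phi> 1 + 1 / 2 * ?\<phi> (- 1)"
      using convex_on_UNIV_combination[OF conv, of "1/2" "1/2" y "- y"] by simp
    then have "0 \<le> c" using \<phi>_eq[of 1] \<phi>_eq[of "- 1"] by (simp add: field_simps)
    then show ?thesis unfolding c_def .
  qed
  ultimately obtain r :: nat and L where L: "\<And>i j. A i j = (\<Sum>l<r. L i l * L j l)"
    using psd_factorization[of "UNIV :: 'n set" A] by auto
  have "hessian p i j = (\<Sum>l<r. pconst (L i l) * pconst (L j l))" for i j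
    by (simp add: A L pconst_sum pconst_mult)
  then show ?thesis
    unfolding gram_def by (intro exI[of _ r] exI[of _ "\<lambda>i l. pconst (L i l)"]) simp
qed

lemma gram_imp_SOS:
  assumes "gram (\<lambda>(_::unit) _. p)" "total_degree p \<le> 2 * k"
  shows "p \<in> SOS k"
proof -
  obtain r :: nat and L where "\<And>i j :: unit. p = (\<Sum>l<r. L i l * L j l)"
    using assms(1) unfolding gram_def by blast
  then have "p = (\<Sum>l<r. (L () l)\<^sup>2)" by (simp add: power2_eq_square)
  then show ?thesis
    using assms(2) unfolding SOS_def
    by (intro CollectI conjI exI[of _ r] exI[of _ "L ()"]) auto
qed

text \<open>Expand around a global minimizer \<open>z\<close>, where the gradient vanishes, and write the constant
\<open>F z - m \<ge> 0\<close> as a square. Thus nonnegativity of SOS-convex polynomials is always certified by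
squares, which fails for polynomials in general.\<close>

lemma sos_convex_minus_lower_bound_is_SOS:
  fixes F :: "'n::finite rpoly"
  assumes conv: "convex_on UNIV (peval F)" and hess: "gram (hessian F)"
    and lower: "\<And>x. m \<le> peval F x"
  shows "gram (\<lambda>(_::unit) _. F - pconst m)"
proof -
  obtain z where z: "\<And>x. peval F z \<le> peval F x"
    using convex_poly_bounded_below_attains_min[OF conv lower] by blast
  have 1: "gram (\<lambda>(_::unit) _. F - pconst (peval F z))"
    by (rule gram_diff_at_critical_point[OF hess]) (rule partial_deriv_zero_at_min[OF z])
  have 2: "gram (\<lambda>(_::unit) _. pconst (sqrt (peval F z - m)) * pconst (sqrt (peval F z - m)))"
    by (rule gram_rank_one)
  have eq: "F - pconst m = (F - pconst (peval F z)) + pconst (sqrt (peval F z - m)) * pconst (sqrt (peval F z - m))"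
    using lower[of z] by (intro peval_inject) simp
  show ?thesis unfolding eq by (rule gram_add[OF 1 2])
qed

section \<open>Exactness of the first relaxation\<close>

text \<open>The index of the product \<open>g j\<close> is the pair of a unit vector and the zero vector. At most one
summand is nonzero at any index; the form of a sum lets the Lagrangian be evaluated by
interchanging two summations.\<close>

definition linear_multiplier :: "('m::finite \<Rightarrow> real) \<Rightarrow> ('m \<Rightarrow> nat) \<times> ('m \<Rightarrow> nat) \<Rightarrow> real" where
  "linear_multiplier \<mu> ab = (\<Sum>j\<in>UNIV. if ab = ((\<lambda>i. if i = j then 1 else 0), (\<lambda>_. 0)) then \<mu> j else 0)"

lemma lagrangian_linear_multiplier:
  fixes g :: "'m::finite \<Rightarrow> 'n::finite rpoly"
  shows "lagrangian f g 1 (linear_multiplier \<mu>) x = peval f x - (\<Sum>j\<in>UNIV. \<mu> j * peval (g j) x)"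
proof -
  let ?e = "\<lambda>j::'m. ((\<lambda>i. if i = j then 1 else 0 :: nat), (\<lambda>_::'m. 0::nat))"
  define T where "T ab = (\<Prod>j\<in>UNIV. peval (g j) x ^ fst ab j) * (\<Prod>j\<in>UNIV. (1 - peval (g j) x) ^ snd ab j)"
    for ab :: "('m \<Rightarrow> nat) \<times> ('m \<Rightarrow> nat)"
  have mem: "?e j \<in> multi_indices 1" for j
    by (simp add: multi_indices_def)
  have T: "T (?e j) = peval (g j) x" for j
  proof -
    have "(\<Prod>i\<in>UNIV. peval (g i) x ^ (if i = j then 1 else 0)) = (\<Prod>i\<in>UNIV. if i = j then peval (g j) x else 1)"
      by (rule prod.cong) auto
    then show ?thesis by (simp add: T_def)
  qed
  have "(\<Sum>(\<alpha>, \<beta>)\<in>multi_indices 1. linear_multiplier \<mu> (\<alpha>, \<beta>) * (\<Prod>j\<in>UNIV. peval (g j) x ^ \<alpha> j)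
          * (\<Prod>j\<in>UNIV. (1 - peval (g j) x) ^ \<beta> j))
      = (\<Sum>ab\<in>multi_indices 1. \<Sum>j\<in>UNIV. if ab = ?e j then \<mu> j * T ab else 0)"
    unfolding linear_multiplier_def sum_distrib_right
    by (intro sum.cong refl) (auto simp: T_def case_prod_unfold sum_distrib_right mult.assoc intro!: sum.cong)
  also have "\<dots> = (\<Sum>j\<in>UNIV. \<Sum>ab\<in>multi_indices 1. if ab = ?e j then \<mu> j * T ab else 0)"
    by (rule sum.swap)
  also have "\<dots> = (\<Sum>j\<in>UNIV. \<mu> j * peval (g j) x)"
    by (intro sum.cong refl) (subst sum.delta[OF finite_multi_indices], simp only: mem T if_True)
  finally show ?thesis by (simp add: lagrangian_def)
qed

text \<open>Weak duality: on the feasible set every product of factors \<open>g j\<close> and \<open>1 - g j\<close> is nonnegative,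
so the Lagrangian lies below the objective.\<close>

lemma relax_values_le:
  assumes bounds: "\<forall>x\<in>feasible_set g. \<forall>j. 0 \<le> peval (g j) x \<and> peval (g j) x \<le> 1"
    and t: "t \<in> relax_values f g d k" and x: "x \<in> feasible_set g"
  shows "t \<le> peval f x"
proof -
  obtain lam \<sigma> where \<sigma>: "\<sigma> \<in> SOS k" and lam: "\<And>ab. ab \<in> multi_indices d \<Longrightarrow> lam ab \<ge> 0"
    and eq: "\<And>x. lagrangian f g d lam x - t = peval \<sigma> x"
    using t unfolding relax_values_def by blast
  have "0 \<le> peval \<sigma> x"
    using \<sigma> unfolding SOS_def by (auto intro!: sum_nonneg)
  then have "t \<le> lagrangian f g d lam x" using eq[of x] by simp
  also have "\<dots> \<le> peval f x"
    unfolding lagrangian_def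
    using bounds x lam by (auto intro!: sum_nonneg mult_nonneg_nonneg prod_nonneg)
  finally show ?thesis .
qed

text \<open>By Slater's condition there are multipliers \<open>\<mu>\<close> for which the Lagrangian
\<open>F = f - \<Sum>\<^sub>j \<mu> j g j\<close> is bounded below by the optimal value \<open>v\<close> on the whole space. As a
nonnegative combination of convex polynomials with Gram Hessians, \<open>F\<close> is of the same kind, so
\<open>F - v\<close> is a sum of squares and \<open>v\<close> itself is a value of the relaxation. Weak duality shows that
it is the largest one.\<close>

lemma first_relaxation_exact:
  fixes f :: "'n::finite rpoly" and g :: "'m::finite \<Rightarrow> 'n rpoly"
  assumes bounds: "\<forall>x\<in>feasible_set g. \<forall>j. 0 \<le> peval (g j) x \<and> peval (g j) x \<le> 1"
    and convex_f: "convex_on UNIV (peval f)"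
    and convex_g: "\<forall>j. convex_on UNIV (peval (- g j))"
    and slater: "\<exists>x0\<in>feasible_set g. \<forall>j. peval (g j) x0 > 0"
    and bounded_below: "opt_value f g > -\<infinity>"
    and deg: "Max (insert (total_degree f) (range (\<lambda>j. total_degree (g j)))) \<le> 2 * k"
    and gram_f: "gram (hessian f)" and gram_g: "\<And>j. gram (hessian (- g j))"
  shows "relax_value f g 1 k = opt_value f g \<and>
         relax_value f g 1 k \<in> ereal ` relax_values f g 1 k"
proof -
  obtain x0 where x0: "x0 \<in> feasible_set g" "\<And>j. peval (g j) x0 > 0" using slater by blast
  have "opt_value f g \<le> ereal (peval f x0)"
    unfolding opt_value_def using x0(1) by (rule INF_lower)
  then obtain v where v: "opt_value f g = ereal v"
    using bounded_below by (cases "opt_value f g") auto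
  have v_le: "v \<le> peval f x" if "x \<in> feasible_set g" for x
  proof -
    have "ereal v \<le> ereal (peval f x)"
      unfolding v[symmetric] opt_value_def using that by (rule INF_lower)
    then show ?thesis by simp
  qed
  \<comment> \<open>The functions \<open>- g j\<close> are the convex constraint functions, required to be nonpositive.\<close>
  obtain \<mu> where \<mu>: "\<And>j. 0 \<le> \<mu> j"
    and dual: "\<And>x. v \<le> peval f x + (\<Sum>j\<in>UNIV. \<mu> j * peval (- g j) x)"
    using slater_multipliers[of "peval f" "\<lambda>j. peval (- g j)" x0 v] convex_f convex_g x0(2) v_le
    by (auto simp: feasible_set_def)
  define F where "F = f + (\<Sum>j\<in>UNIV. pconst (\<mu> j) * - g j)"
  have peval_F: "peval F x = peval f x + (\<Sum>j\<in>UNIV. \<mu> j * peval (- g j) x)" for x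
    by (simp add: F_def)
  have "convex_on UNIV (\<lambda>x. \<Sum>j\<in>A. \<mu> j * peval (- g j) x)" if "finite A" for A
    using that
  proof (induction A rule: finite_induct)
    case empty
    show ?case by (simp add: convex_on_const)
  next
    case (insert j A)
    have "convex_on UNIV (\<lambda>x. \<mu> j * peval (- g j) x)"
      using convex_g by (intro convex_on_cmul \<mu>) blast
    then show ?case using insert by (simp add: convex_on_add del: peval_uminus)
  qed
  then have "convex_on UNIV (\<lambda>x. peval f x + (\<Sum>j\<in>UNIV. \<mu> j * peval (- g j) x))"
    by (intro convex_on_add convex_f) simp
  then have conv_F: "convex_on UNIV (peval F)"
    unfolding peval_F[symmetric] .
  have "hessian F = (\<lambda>i j. hessian f i j + (\<Sum>a\<in>UNIV. pconst (\<mu> a) * hessian (- g a) i j))"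
    unfolding F_def by (intro ext) (simp only: hessian_add hessian_sum hessian_pconst_mult)
  then have gram_F: "gram (hessian F)"
    using gram_f gram_g \<mu> by (simp add: gram_add gram_sum gram_nonneg_mult)
  have deg_f: "total_degree f \<le> 2 * k" and deg_g: "total_degree (g j) \<le> 2 * k" for j
    using deg by auto
  have "total_degree (F + pconst (- v)) \<le> 2 * k"
    unfolding F_def using deg_f deg_g
    by (intro total_degree_add_le total_degree_sum_le total_degree_pconst_mult_le) auto
  moreover have "F + pconst (- v) = F - pconst v"
    by (rule peval_inject) simp
  ultimately have deg_F: "total_degree (F - pconst v) \<le> 2 * k" by simp
  have "gram (\<lambda>(_::unit) _. F - pconst v)"
    using dual by (intro sos_convex_minus_lower_bound_is_SOS[OF conv_F gram_F]) (simp only: peval_F)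
  then have "F - pconst v \<in> SOS k"
    using deg_F by (rule gram_imp_SOS)
  moreover have "lagrangian f g 1 (linear_multiplier \<mu>) x - v = peval (F - pconst v) x" for x
    unfolding lagrangian_linear_multiplier by (simp add: peval_F sum_negf)
  moreover have "\<forall>ab\<in>multi_indices 1. 0 \<le> linear_multiplier \<mu> ab"
    using \<mu> by (auto simp: linear_multiplier_def intro!: sum_nonneg)
  ultimately have attained: "v \<in> relax_values f g 1 k"
    unfolding relax_values_def by blast
  have "ereal t \<le> ereal v" if "t \<in> relax_values f g 1 k" for t
    unfolding v[symmetric] opt_value_def
    using relax_values_le[OF bounds that] by (intro INF_greatest) simp
  then have "relax_value f g 1 k = ereal v"
    unfolding relax_value_def using attained by (intro antisym SUP_least SUP_upper) auto
  then show ?thesis using v attained by auto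
qed

theorem theorem4p1:
  fixes f :: "'n::finite rpoly" and g :: "'m::finite \<Rightarrow> 'n rpoly"
  assumes bounds: "\<forall>x\<in>feasible_set g. \<forall>j. 0 \<le> peval (g j) x \<and> peval (g j) x \<le> 1"
    and convex_f: "convex_on UNIV (peval f)"
    and convex_g: "\<forall>j. convex_on UNIV (peval (- g j))"
    and slater: "\<exists>x0\<in>feasible_set g. \<forall>j. peval (g j) x0 > 0"
    and bounded_below: "opt_value f g > -\<infinity>"
  shows "(Max (insert (total_degree f) (range (\<lambda>j. total_degree (g j)))) \<le> 2 \<longrightarrow>
            relax_value f g 1 1 = opt_value f g \<and>
            relax_value f g 1 1 \<in> ereal ` relax_values f g 1 1) \<and>
         (\<forall>k. Max (insert (total_degree f) (range (\<lambda>j. total_degree (g j)))) \<le> 2 * k \<and>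
              sos_convex f \<and> (\<forall>j. sos_convex (- g j)) \<longrightarrow>
            relax_value f g 1 k = opt_value f g \<and>
            relax_value f g 1 k \<in> ereal ` relax_values f g 1 k)"
proof (intro conjI impI allI; (elim conjE)?)
  assume deg: "Max (insert (total_degree f) (range (\<lambda>j. total_degree (g j)))) \<le> 2"
  have "gram (hessian f)"
    using deg by (intro convex_quadratic_gram_hessian convex_f) auto
  moreover have "gram (hessian (- g j))" for j
    using deg convex_g by (intro convex_quadratic_gram_hessian) auto
  ultimately have *: "relax_value f g 1 1 = opt_value f g \<and>
      relax_value f g 1 1 \<in> ereal ` relax_values f g 1 1"
    using deg by (intro first_relaxation_exact assms) auto
  show "relax_value f g 1 1 = opt_value f g" using * ..
  show "relax_value f g 1 1 \<in> ereal ` relax_values f g 1 1" using * ..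
next
  fix k
  assume "Max (insert (total_degree f) (range (\<lambda>j. total_degree (g j)))) \<le> 2 * k"
    "sos_convex f" "\<forall>j. sos_convex (- g j)"
  then have *: "relax_value f g 1 k = opt_value f g \<and>
      relax_value f g 1 k \<in> ereal ` relax_values f g 1 k"
    by (intro first_relaxation_exact assms sos_convex_imp_gram_hessian) auto
  show "relax_value f g 1 k = opt_value f g" using * ..
  show "relax_value f g 1 k \<in> ereal ` relax_values f g 1 k" using * ..
qed

end
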